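(* $$\int_0^1\frac{\mathbf K\big(2\sqrt{x(1-x)}\big)\,x(1-x)}{[1-2x(1-x)]^{3/2}}\,dx=\frac{\pi}{2\sqrt{2}}.$$
   Context: $\mathbf K(k)=\int_0^{\pi/2}\frac{d\theta}{\sqrt{1-k^2\sin^2\theta}}$ denotes the complete elliptic integral of the first kind with modulus $k$. *)

theory Defs
  imports "HOL-Analysis.Analysis"
begin

(* The argument is the modulus k (not the parameter m = k^2).  At k = 1 the defining integral
   diverges, and "integral" then returns the dummy value 0. *)
definition elliptic_K :: "real \<Rightarrow> real" where
  "elliptic_K k = integral {0..pi / 2} (\<lambda>\<theta>. 1 / sqrt (1 - k\<^sup>2 * (sin \<theta>)\<^sup>2))"

end

theory Submission
  imports Defs
begin

text \<open>
  The integral is, up to a constant, the integral of \<open>1 / sqrt (1 - y)\<close> over half of the unit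
  sphere, \<open>y\<close> being a Cartesian coordinate, and so it falls to Archimedes' theorem that the area of
  the sphere is uniformly distributed along any axis.

  Put \<open>x = (1 + tan (\<beta>/2)) / 2\<close> with \<open>-\<pi>/2 \<le> \<beta> \<le> \<pi>/2\<close> and \<open>c = cos \<beta>\<close>. Then the squared modulus
  is \<open>k\<^sup>2 = 4 x (1 - x) = 2 c / (1 + c)\<close>, the radicand under \<open>K\<close> becomes
  \<open>1 - k\<^sup>2 sin\<^sup>2 \<theta> = (1 + c cos 2\<theta>) / (1 + c)\<close>, and the powers of \<open>1 + c\<close> coming from this radicand,
  from the weight and from \<open>dx = d\<beta> / (2 (1 + c))\<close> cancel. What remains is
  \<open>1/4 \<integral>\<integral> cos \<beta> / sqrt (1 + cos \<beta> cos 2\<theta>) d\<theta> d\<beta>\<close> with \<open>0 \<le> \<theta> \<le> \<pi>/2\<close>.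

  Read \<open>\<beta>\<close> as latitude and \<open>2\<theta>\<close> as longitude: \<open>cos \<beta> d(2\<theta>) d\<beta>\<close> is the area element and
  \<open>- cos \<beta> cos 2\<theta>\<close> is the coordinate \<open>y\<close>. Archimedes' theorem (\<open>nn_integral_half_sphere\<close>) turns the
  double integral into \<open>\<pi>/2\<close> times \<open>\<integral> 1 / sqrt (1 - y) dy = 2 sqrt 2\<close> over \<open>[-1, 1]\<close>.

  Every integrand is nonnegative, so all the work is done with extended nonnegative integrals. There
  Tonelli's theorem and the substitution rule need no integrability, and the logarithmic singularity
  of \<open>K\<close> at \<open>x = 1/2\<close> needs no separate estimate.
\<close>

section \<open>The area of the sphere in Cartesian coordinates\<close>

text \<open>The density of the area of the hemisphere over its equatorial disc, with respect to the
  Lebesgue measure of the disc.\<close>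
definition hemisphere_weight :: "real \<Rightarrow> real \<Rightarrow> real" where
  "hemisphere_weight y z = (if y\<^sup>2 + z\<^sup>2 < 1 then 1 / sqrt (1 - y\<^sup>2 - z\<^sup>2) else 0)"

lemma hemisphere_weight_commute: "hemisphere_weight y z = hemisphere_weight z y"
  by (simp add: hemisphere_weight_def add.commute algebra_simps)

lemma measurable_hemisphere_weight [measurable]:
  assumes [measurable]: "g \<in> borel_measurable M" "h \<in> borel_measurable M"
  shows "(\<lambda>x. hemisphere_weight (g x) (h x)) \<in> borel_measurable M"
  unfolding hemisphere_weight_def by measurable

lemma ennreal_two_mult_half: "ennreal 2 * ennreal (1/2) = 1"
  by (subst ennreal_mult'[symmetric]) auto

text \<open>Integration over the longitude at fixed height \<open>z = sin \<beta>\<close>, where the circle of latitude has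
  radius \<open>c\<close>. The substitution is \<open>y = - c cos 2\<theta>\<close>, along which \<open>1 - y\<^sup>2 - z\<^sup>2 = (c sin 2\<theta>)\<^sup>2\<close>: the
  density is exactly the reciprocal of half the Jacobian. The sign makes \<open>y\<close> increase with
  \<open>\<theta>\<close>.\<close>
lemma nn_integral_chord:
  fixes f :: "real \<Rightarrow> ennreal"
  assumes [measurable]: "f \<in> borel_measurable borel"
    and c: "0 < c" "c\<^sup>2 + z\<^sup>2 = 1"
  shows "(\<integral>\<^sup>+\<theta>. f (- (c * cos (2 * \<theta>))) * indicator {0..pi/2} \<theta> \<partial>lborel)
       = ennreal (1/2) * (\<integral>\<^sup>+y. f y * ennreal (hemisphere_weight y z) \<partial>lborel)"
proof -
  define g where "g \<theta> = - (c * cos (2 * \<theta>))" for \<theta>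
  define g' where "g' \<theta> = 2 * c * sin (2 * \<theta>)" for \<theta>
  have "(\<integral>\<^sup>+y. (f y * ennreal (hemisphere_weight y z)) * indicator {g 0..g (pi/2)} y \<partial>lborel)
      = (\<integral>\<^sup>+\<theta>. (f (g \<theta>) * ennreal (hemisphere_weight (g \<theta>) z)) * ennreal (g' \<theta>) * indicator {0..pi/2} \<theta> \<partial>lborel)"
  proof (rule nn_integral_substitution_aux)
    show "(g has_real_derivative g' x) (at x)" for x
      unfolding g_def g'_def by (auto intro!: derivative_eq_intros)
    show "continuous_on {0..pi/2} g'"
      unfolding g'_def by (intro continuous_intros)
    show "0 \<le> g' x" if "x \<in> {0..pi/2}" for x
      unfolding g'_def using that c by (auto intro!: mult_nonneg_nonneg sin_ge_zero)
  qed auto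
  also have "\<dots> = (\<integral>\<^sup>+\<theta>. ennreal 2 * (f (g \<theta>) * indicator {0..pi/2} \<theta>) \<partial>lborel)"
  proof (rule nn_integral_cong_AE)
    have "AE \<theta> in lborel. \<theta> \<notin> {0, pi/2}"
      by (rule AE_not_in) (auto intro: countable_imp_null_set_lborel)
    then show "AE \<theta> in lborel. f (g \<theta>) * ennreal (hemisphere_weight (g \<theta>) z) * ennreal (g' \<theta>) * indicator {0..pi/2} \<theta>
        = ennreal 2 * (f (g \<theta>) * indicator {0..pi/2} \<theta>)"
    proof eventually_elim
      case (elim \<theta>)
      show ?case
      proof (cases "\<theta> \<in> {0..pi/2}")
        case True
        then have "0 < sin (2 * \<theta>)"
          using elim by (intro sin_gt_zero) auto
        then have p: "0 < c * sin (2 * \<theta>)" using c by simp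
        have e: "1 - (g \<theta>)\<^sup>2 - z\<^sup>2 = (c * sin (2 * \<theta>))\<^sup>2"
          using c(2) sin_cos_squared_add[of "2 * \<theta>"] unfolding g_def by algebra
        have "(g \<theta>)\<^sup>2 + z\<^sup>2 < 1"
          using e zero_less_power[OF p, of 2] by linarith
        then have w: "hemisphere_weight (g \<theta>) z = 1 / (c * sin (2 * \<theta>))"
          using p e unfolding hemisphere_weight_def by (simp add: real_sqrt_mult)
        have "ennreal (hemisphere_weight (g \<theta>) z) * ennreal (g' \<theta>)
            = ennreal (hemisphere_weight (g \<theta>) z * g' \<theta>)"
          unfolding w using p by (intro ennreal_mult'[symmetric]) simp
        also have "hemisphere_weight (g \<theta>) z * g' \<theta> = 2"
          unfolding w g'_def using p by auto
        finally have "ennreal (hemisphere_weight (g \<theta>) z) * ennreal (g' \<theta>) = ennreal 2" .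
        with True show ?thesis by (simp add: mult.assoc mult.commute[of _ "f _"])
      qed simp
    qed
  qed
  also have "\<dots> = ennreal 2 * (\<integral>\<^sup>+\<theta>. f (g \<theta>) * indicator {0..pi/2} \<theta> \<partial>lborel)"
    unfolding g_def by (intro nn_integral_cmult) measurable
  also have "(\<integral>\<^sup>+y. (f y * ennreal (hemisphere_weight y z)) * indicator {g 0..g (pi/2)} y \<partial>lborel)
     = (\<integral>\<^sup>+y. f y * ennreal (hemisphere_weight y z) \<partial>lborel)"
  proof (rule nn_integral_cong)
    fix y :: real
    have "y \<in> {-c..c}" if "y\<^sup>2 + z\<^sup>2 < 1"
    proof -
      have "y\<^sup>2 \<le> c\<^sup>2" using that c by linarith
      then have "\<bar>y\<bar> \<le> c" using c(1) by (metis abs_le_square_iff abs_of_pos)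
      then show ?thesis by auto
    qed
    then show "f y * ennreal (hemisphere_weight y z) * indicator {g 0..g (pi/2)} y
        = f y * ennreal (hemisphere_weight y z)"
      by (auto simp: g_def hemisphere_weight_def split: split_indicator)
  qed
  finally show ?thesis
    unfolding g_def
    using ennreal_two_mult_half by (metis (no_types, lifting) mult.assoc mult.commute mult_1)
qed

text \<open>Taking a constant function in the previous lemma shows that all chords carry the same mass. This is
  what makes the projection of the area onto an axis uniform.\<close>
lemma nn_integral_hemisphere_weight:
  assumes "\<bar>z\<bar> < 1"
  shows "(\<integral>\<^sup>+y. ennreal (hemisphere_weight y z) \<partial>lborel) = ennreal pi"
proof -
  have z: "z\<^sup>2 < 1" using assms by (simp add: abs_square_less_1)
  have "ennreal 2 * ennreal (1/2) * (\<integral>\<^sup>+y. ennreal (hemisphere_weight y z) \<partial>lborel)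
      = ennreal 2 * ennreal (pi/2)"
    using nn_integral_chord[of "\<lambda>_. 1" "sqrt (1 - z\<^sup>2)" z] z by (simp add: mult.assoc)
  also have "\<dots> = ennreal pi"
    by (subst ennreal_mult'[symmetric]) auto
  finally show ?thesis
    unfolding ennreal_two_mult_half by simp
qed

text \<open>Archimedes' theorem. Latitude and longitude are adapted to the \<open>z\<close> axis, whereas \<open>f\<close> depends on
  \<open>y\<close> only. Passing to the coordinates \<open>(y, z)\<close> of the disc makes the two axes interchangeable: the
  density is symmetric in them, so after Tonelli's theorem the inner integral is again the mass of a
  chord.\<close>
lemma nn_integral_half_sphere:
  fixes f :: "real \<Rightarrow> ennreal"
  assumes [measurable]: "f \<in> borel_measurable borel"
  shows "(\<integral>\<^sup>+\<beta>. (\<integral>\<^sup>+\<theta>. f (- (cos \<beta> * cos (2 * \<theta>))) * indicator {0..pi/2} \<theta> \<partial>lborel)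
             * ennreal (cos \<beta>) * indicator {-(pi/2)..pi/2} \<beta> \<partial>lborel)
       = ennreal (pi/2) * (\<integral>\<^sup>+y. f y * indicator {-1..1} y \<partial>lborel)"
proof -
  define G where "G z = ennreal (1/2) * (\<integral>\<^sup>+y. f y * ennreal (hemisphere_weight y z) \<partial>lborel)" for z
  have [measurable]: "G \<in> borel_measurable borel"
    unfolding G_def by measurable
  have ends: "AE z in lborel. z \<notin> {-a, a}" for a :: real
    by (rule AE_not_in) (auto intro: countable_imp_null_set_lborel)
  have "(\<integral>\<^sup>+\<beta>. (\<integral>\<^sup>+\<theta>. f (- (cos \<beta> * cos (2 * \<theta>))) * indicator {0..pi/2} \<theta> \<partial>lborel)
             * ennreal (cos \<beta>) * indicator {-(pi/2)..pi/2} \<beta> \<partial>lborel)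
      = (\<integral>\<^sup>+\<beta>. G (sin \<beta>) * ennreal (cos \<beta>) * indicator {-(pi/2)..pi/2} \<beta> \<partial>lborel)"
  proof (rule nn_integral_cong_AE)
    show "AE \<beta> in lborel. (\<integral>\<^sup>+\<theta>. f (- (cos \<beta> * cos (2 * \<theta>))) * indicator {0..pi/2} \<theta> \<partial>lborel)
             * ennreal (cos \<beta>) * indicator {-(pi/2)..pi/2} \<beta>
        = G (sin \<beta>) * ennreal (cos \<beta>) * indicator {-(pi/2)..pi/2} \<beta>"
      using ends[of "pi/2"]
    proof eventually_elim
      case (elim \<beta>)
      show ?case
      proof (cases "\<beta> \<in> {-(pi/2)..pi/2}")
        case True
        then have "0 < cos \<beta>" using elim by (intro cos_gt_zero_pi) auto
        then show ?thesis
          by (subst nn_integral_chord[of _ _ "sin \<beta>"]) (auto simp: G_def)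
      qed simp
    qed
  qed
  also have "\<dots> = (\<integral>\<^sup>+z. G z * indicator {sin (-(pi/2))..sin (pi/2)} z \<partial>lborel)"
    by (rule nn_integral_substitution_aux[symmetric])
       (auto intro!: derivative_eq_intros continuous_intros cos_ge_zero)
  also have "\<dots> = (\<integral>\<^sup>+z. (\<integral>\<^sup>+y. ennreal (1/2) * f y * ennreal (hemisphere_weight y z) \<partial>lborel) \<partial>lborel)"
  proof (rule nn_integral_cong)
    fix z :: real
    have "hemisphere_weight y z = 0" if "z \<notin> {-1..1}" for y
    proof -
      have "1 < \<bar>z\<bar>" using that by auto
      then have "1 \<le> z\<^sup>2" using abs_square_less_1[of z] by linarith
      then have "\<not> y\<^sup>2 + z\<^sup>2 < 1" using zero_le_power2[of y] by linarith
      then show ?thesis by (simp add: hemisphere_weight_def)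
    qed
    then show "G z * indicator {sin (-(pi/2))..sin (pi/2)} z
       = (\<integral>\<^sup>+y. ennreal (1/2) * f y * ennreal (hemisphere_weight y z) \<partial>lborel)"
      unfolding G_def
      by (cases "z \<in> {-1..1}") (auto simp: mult.assoc nn_integral_cmult)
  qed
  also have "\<dots> = (\<integral>\<^sup>+y. (\<integral>\<^sup>+z. ennreal (1/2) * f y * ennreal (hemisphere_weight y z) \<partial>lborel) \<partial>lborel)"
    by (rule lborel_pair.Fubini') measurable
  also have "\<dots> = (\<integral>\<^sup>+y. ennreal (pi/2) * (f y * indicator {-1..1} y) \<partial>lborel)"
  proof (rule nn_integral_cong_AE)
    show "AE y in lborel. (\<integral>\<^sup>+z. ennreal (1/2) * f y * ennreal (hemisphere_weight y z) \<partial>lborel)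
        = ennreal (pi/2) * (f y * indicator {-1..1} y)"
      using ends[of 1]
    proof eventually_elim
      case (elim y)
      show ?case
      proof (cases "y \<in> {-1..1}")
        case True
        then have "\<bar>y\<bar> < 1" using elim by auto
        then have "(\<integral>\<^sup>+z. ennreal (hemisphere_weight y z) \<partial>lborel) = ennreal pi"
          using nn_integral_hemisphere_weight[of y] by (subst hemisphere_weight_commute)
        moreover have "ennreal (pi/2) = ennreal (1/2) * ennreal pi"
          by (subst ennreal_mult'[symmetric]) auto
        moreover have "(\<integral>\<^sup>+z. ennreal (1/2) * f y * ennreal (hemisphere_weight y z) \<partial>lborel)
            = ennreal (1/2) * f y * (\<integral>\<^sup>+z. ennreal (hemisphere_weight y z) \<partial>lborel)"
          by (intro nn_integral_cmult) measurable
        ultimately show ?thesis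
          using True by (simp only: indicator_simps mult_1_left mult_1_right mult_ac)
      next
        case False
        then have "1 < \<bar>y\<bar>" by auto
        then have "1 \<le> y\<^sup>2" using abs_square_less_1[of y] by linarith
        then have "hemisphere_weight y z = 0" for z
          using zero_le_power2[of z] unfolding hemisphere_weight_def by (simp add: add_increasing2 not_less)
        with False show ?thesis by simp
      qed
    qed
  qed
  also have "\<dots> = ennreal (pi/2) * (\<integral>\<^sup>+y. f y * indicator {-1..1} y \<partial>lborel)"
    by (intro nn_integral_cmult) measurable
  finally show ?thesis .
qed

lemma nn_integral_inverse_sqrt:
  "(\<integral>\<^sup>+y. ennreal (1 / sqrt (1 - y)) * indicator {-1..1} y \<partial>lborel) = ennreal (2 * sqrt 2)"
proof -
  have "((\<lambda>y. 1 / sqrt (1 - y)) has_integral (- 2 * sqrt (1 - 1) - (- 2 * sqrt (1 - (-1)))) ) {-1..1::real}"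
  proof (rule fundamental_theorem_of_calculus_interior)
    show "((\<lambda>y. - 2 * sqrt (1 - y)) has_vector_derivative 1 / sqrt (1 - x)) (at x)"
      if "x \<in> {-1<..<1}" for x :: real
      using that unfolding has_real_derivative_iff_has_vector_derivative[symmetric]
      by (auto intro!: derivative_eq_intros simp: divide_simps)
  qed (auto intro!: continuous_intros)
  then show ?thesis
    using nn_integral_has_integral_lebesgue'[of "{-1..1}" "\<lambda>y. 1 / sqrt (1 - y)"] by simp
qed

section \<open>The elliptic integral in terms of latitude\<close>

text \<open>Unlike \<open>elliptic_K\<close>, this version is visibly a measurable function of the modulus, and it takes the value
  \<open>\<infinity>\<close> where the defining integral diverges, which lets Tonelli's theorem run without exceptional
  points.\<close>
definition nn_elliptic_K :: "real \<Rightarrow> ennreal" where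
  "nn_elliptic_K k = (\<integral>\<^sup>+\<theta>. ennreal (1 / sqrt (1 - k\<^sup>2 * (sin \<theta>)\<^sup>2)) * indicator {0..pi/2} \<theta> \<partial>lborel)"

lemma measurable_nn_elliptic_K [measurable]: "nn_elliptic_K \<in> borel_measurable borel"
  unfolding nn_elliptic_K_def by measurable

lemma elliptic_K_radicand:
  fixes k \<theta> :: real
  assumes "k\<^sup>2 < 1"
  shows "k\<^sup>2 * (sin \<theta>)\<^sup>2 < 1"
proof -
  have "(sin \<theta>)\<^sup>2 \<le> 1" by (simp add: abs_square_le_1)
  then have "k\<^sup>2 * (sin \<theta>)\<^sup>2 \<le> k\<^sup>2 * 1" by (intro mult_left_mono) auto
  then show ?thesis using assms by linarith
qed

lemma elliptic_K_has_integral: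
  assumes "k\<^sup>2 < 1"
  shows "((\<lambda>\<theta>. 1 / sqrt (1 - k\<^sup>2 * (sin \<theta>)\<^sup>2)) has_integral elliptic_K k) {0..pi/2}"
proof -
  have "1 - k\<^sup>2 * (sin \<theta>)\<^sup>2 \<noteq> 0" for \<theta>
    using elliptic_K_radicand[OF assms, of \<theta>] by simp
  then have "(\<lambda>\<theta>. 1 / sqrt (1 - k\<^sup>2 * (sin \<theta>)\<^sup>2)) integrable_on {0..pi/2}"
    by (intro integrable_continuous_interval continuous_intros) auto
  then show ?thesis
    unfolding elliptic_K_def by (rule integrable_integral)
qed

lemma elliptic_K_nonneg:
  assumes "k\<^sup>2 < 1"
  shows "0 \<le> elliptic_K k"
  using elliptic_K_has_integral[OF assms]
  by (rule has_integral_nonneg) (simp add: elliptic_K_radicand[OF assms] less_imp_le)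

lemma nn_elliptic_K_eq:
  assumes "k\<^sup>2 < 1"
  shows "nn_elliptic_K k = ennreal (elliptic_K k)"
  unfolding nn_elliptic_K_def using elliptic_K_has_integral[OF assms]
  by (intro nn_integral_has_integral_lebesgue')
     (simp_all add: elliptic_K_radicand[OF assms] less_imp_le)

text \<open>The square of the modulus is chosen so that replacing \<open>sin\<^sup>2 \<theta>\<close> by \<open>(1 - cos 2\<theta>) / 2\<close> leaves,
  up to the factor \<open>1 + c\<close>, a function of the sphere's coordinate \<open>- c cos 2\<theta>\<close> alone. At \<open>c = 1\<close> both
  sides are infinite.\<close>
lemma nn_elliptic_K_double_angle:
  assumes c: "0 \<le> c" and k: "k\<^sup>2 = 2 * c / (1 + c)"
  shows "nn_elliptic_K k = ennreal (sqrt (1 + c)) *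
     (\<integral>\<^sup>+\<theta>. ennreal (1 / sqrt (1 - (- (c * cos (2 * \<theta>))))) * indicator {0..pi/2} \<theta> \<partial>lborel)"
proof -
  have "1 - k\<^sup>2 * (sin \<theta>)\<^sup>2 = (1 + c * cos (2 * \<theta>)) / (1 + c)" for \<theta>
    using c unfolding k cos_double_sin by (simp add: field_simps)
  then have "ennreal (1 / sqrt (1 - k\<^sup>2 * (sin \<theta>)\<^sup>2))
     = ennreal (sqrt (1 + c)) * ennreal (1 / sqrt (1 - (- (c * cos (2 * \<theta>)))))" for \<theta>
    using c by (simp add: real_sqrt_divide flip: ennreal_mult')
  then show ?thesis
    unfolding nn_elliptic_K_def by (simp add: mult.assoc nn_integral_cmult)
qed

text \<open>All three identities come from \<open>tan\<^sup>2 (\<beta>/2) = (1 - cos \<beta>) / (1 + cos \<beta>)\<close>; the last one is the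
  Jacobian of \<open>\<beta> \<mapsto> (1 + tan (\<beta>/2)) / 2\<close>.\<close>
lemma half_angle_weight:
  fixes \<beta> :: real
  defines "x \<equiv> (1 + tan (\<beta>/2)) / 2" and "c \<equiv> cos \<beta>"
  assumes "-1 < cos \<beta>"
  shows "x * (1 - x) = c / (2 * (1 + c))"
    and "1 - 2 * x * (1 - x) = 1 / (1 + c)"
    and "inverse ((cos (\<beta>/2))\<^sup>2) / 4 = 1 / (2 * (1 + c))"
proof -
  have pos: "0 < 1 + c" using assms by simp
  have c2: "c = 2 * (cos (\<beta>/2))\<^sup>2 - 1" unfolding c_def using cos_double_cos[of "\<beta>/2"] by simp
  then have h: "(cos (\<beta>/2))\<^sup>2 = (1 + c) / 2" by simp
  have "(tan (\<beta>/2))\<^sup>2 = (1 - c) / (1 + c)"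
    unfolding tan_def power_divide sin_squared_eq h using pos by (simp add: field_simps)
  moreover have "x * (1 - x) = (1 - (tan (\<beta>/2))\<^sup>2) / 4"
    unfolding x_def by (simp add: field_simps power2_eq_square)
  ultimately have "x * (1 - x) = (1 - (1 - c) / (1 + c)) / 4" by simp
  also have "\<dots> = c / (2 * (1 + c))" using pos by (simp add: field_simps)
  finally show 1: "x * (1 - x) = c / (2 * (1 + c))" .
  have "1 - 2 * x * (1 - x) = 1 - 2 * (x * (1 - x))" by simp
  then show "1 - 2 * x * (1 - x) = 1 / (1 + c)"
    unfolding 1 using pos by (simp add: field_simps)
  show "inverse ((cos (\<beta>/2))\<^sup>2) / 4 = 1 / (2 * (1 + c))"
    unfolding h using pos by (simp add: field_simps)
qed

section \<open>Evaluation of the integral\<close>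

lemma nn_integral_elliptic_K_weighted:
  "(\<integral>\<^sup>+x. nn_elliptic_K (2 * sqrt (x * (1 - x))) * ennreal (x * (1 - x) / (1 - 2 * x * (1 - x)) powr (3/2))
      * indicator {0..1} x \<partial>lborel) = ennreal (pi / (2 * sqrt 2))"
proof -
  define E where "E x = nn_elliptic_K (2 * sqrt (x * (1 - x))) *
    ennreal (x * (1 - x) / (1 - 2 * x * (1 - x)) powr (3/2))" for x
  define J where "J c = (\<integral>\<^sup>+\<theta>. ennreal (1 / sqrt (1 - (- (c * cos (2 * \<theta>))))) * indicator {0..pi/2} \<theta> \<partial>lborel)" for c
  define g where "g \<beta> = (1 + tan (\<beta>/2)) / 2" for \<beta> :: real
  define g' where "g' \<beta> = inverse ((cos (\<beta>/2))\<^sup>2) / 4" for \<beta> :: real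
  have [measurable]: "E \<in> borel_measurable borel" "J \<in> borel_measurable borel"
    unfolding E_def J_def by measurable
  have nz: "cos (\<beta>/2) \<noteq> 0" if "\<beta> \<in> {-(pi/2)..pi/2}" for \<beta>
    using that cos_gt_zero_pi[of "\<beta>/2"] pi_gt_zero by auto
  have "(\<integral>\<^sup>+x. E x * indicator {g (-(pi/2))..g (pi/2)} x \<partial>lborel)
      = (\<integral>\<^sup>+\<beta>. E (g \<beta>) * ennreal (g' \<beta>) * indicator {-(pi/2)..pi/2} \<beta> \<partial>lborel)"
  proof (rule nn_integral_substitution_aux)
    show "(g has_real_derivative g' \<beta>) (at \<beta>)" if "\<beta> \<in> {-(pi/2)..pi/2}" for \<beta>
      using nz[OF that] unfolding g_def g'_def
      by (auto intro!: derivative_eq_intros)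
    show "continuous_on {-(pi/2)..pi/2} g'"
      unfolding g'_def using nz by (intro continuous_intros) auto
  qed (auto simp: g'_def)
  also have "\<dots> = (\<integral>\<^sup>+\<beta>. ennreal (1/4) * (J (cos \<beta>) * ennreal (cos \<beta>) * indicator {-(pi/2)..pi/2} \<beta>) \<partial>lborel)"
  proof (rule nn_integral_cong)
    fix \<beta> :: real
    show "E (g \<beta>) * ennreal (g' \<beta>) * indicator {-(pi/2)..pi/2} \<beta>
      = ennreal (1/4) * (J (cos \<beta>) * ennreal (cos \<beta>) * indicator {-(pi/2)..pi/2} \<beta>)"
    proof (cases "\<beta> \<in> {-(pi/2)..pi/2}")
      case True
      define c where "c = cos \<beta>"
      have c0: "0 \<le> c" unfolding c_def using True by (intro cos_ge_zero) auto
      then have c1: "-1 < cos \<beta>" unfolding c_def by simp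
      note hw = half_angle_weight[OF c1, folded g_def c_def]
      have K: "nn_elliptic_K (2 * sqrt (g \<beta> * (1 - g \<beta>))) = ennreal (sqrt (1 + c)) * J c"
        unfolding J_def using c0 by (intro nn_elliptic_K_double_angle) (auto simp: hw power_mult_distrib field_simps)
      have "(1 / (1 + c)) powr (3/2) = 1 / ((1 + c) * sqrt (1 + c))"
      proof -
        have "(1 + c) powr (3/2) = (1 + c) powr 1 * (1 + c) powr (1/2)"
          by (subst powr_add[symmetric]) simp
        then show ?thesis using c0 by (simp add: powr_divide powr_half_sqrt)
      qed
      moreover have "s * (c / (2 * d) / (1 / (d * s))) * (1 / (2 * d)) = c / 4"
        if "0 < d" "s * s = d" for s d :: real
      proof -
        have "s * (c / (2 * d) / (1 / (d * s))) * (1 / (2 * d)) = c * (s * s) / (4 * d)"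
          using that(1) by (simp add: divide_simps)
        then show ?thesis using that by simp
      qed
      from this[of "1 + c" "sqrt (1 + c)"]
      have "sqrt (1 + c) * (c / (2 * (1 + c)) / (1 / ((1 + c) * sqrt (1 + c)))) * (1 / (2 * (1 + c))) = c / 4"
        using c0 by simp
      ultimately have "sqrt (1 + c) * (c / (2 * (1 + c)) / (1 / (1 + c)) powr (3/2)) * (1 / (2 * (1 + c))) = c / 4"
        by (simp only:)
      then have W: "ennreal (sqrt (1 + c)) * ennreal (c / (2 * (1 + c)) / (1 / (1 + c)) powr (3/2)) * ennreal (1 / (2 * (1 + c)))
         = ennreal (1/4) * ennreal c"
        using c0 by (simp flip: ennreal_mult')
      have "E (g \<beta>) * ennreal (g' \<beta>) = J c * (ennreal (sqrt (1 + c)) * ennreal (c / (2 * (1 + c)) / (1 / (1 + c)) powr (3/2)) * ennreal (1 / (2 * (1 + c))))"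
        unfolding E_def K unfolding g'_def hw by (simp only: mult_ac)
      also have "\<dots> = ennreal (1/4) * (J c * ennreal c)"
        unfolding W by (simp only: mult_ac)
      finally show ?thesis using True by (simp add: c_def)
    qed simp
  qed
  also have "\<dots> = ennreal (1/4) * (ennreal (pi/2) * ennreal (2 * sqrt 2))"
    using nn_integral_half_sphere[of "\<lambda>y. ennreal (1 / sqrt (1 - y))"]
    by (subst nn_integral_cmult) (auto simp: J_def nn_integral_inverse_sqrt)
  also have "\<dots> = ennreal (pi / (2 * sqrt 2))"
    by (simp add: real_div_sqrt field_simps flip: ennreal_mult')
  finally show ?thesis
    by (simp add: E_def g_def tan_45)
qed

theorem mainTheorem5:
  shows "((\<lambda>x::real. elliptic_K (2 * sqrt (x * (1 - x))) * (x * (1 - x))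
            / (1 - 2 * x * (1 - x)) powr (3 / 2))
          has_integral pi / (2 * sqrt 2)) {0..1}"
proof -
  define E where "E x = nn_elliptic_K (2 * sqrt (x * (1 - x))) *
    ennreal (x * (1 - x) / (1 - 2 * x * (1 - x)) powr (3/2)) * indicator {0..1} x" for x
  have [measurable]: "E \<in> borel_measurable borel"
    unfolding E_def by measurable
  have total: "(\<integral>\<^sup>+x. E x \<partial>lborel) = ennreal (pi / (2 * sqrt 2))"
    unfolding E_def by (rule nn_integral_elliptic_K_weighted)
  have "AE x in lborel. E x \<noteq> \<infinity>"
    by (rule nn_integral_PInf_AE) (auto simp: total)
  then have "(\<integral>\<^sup>+x. ennreal (enn2real (E x)) \<partial>lborel) = (\<integral>\<^sup>+x. E x \<partial>lborel)"
    by (intro nn_integral_cong_AE) (auto simp: less_top elim: eventually_mono)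
  then have "((\<lambda>x. enn2real (E x)) has_integral pi / (2 * sqrt 2)) UNIV"
    by (intro nn_integral_has_integral) (auto simp: total)
  moreover have "enn2real (E x) = (if x \<in> {0..1} then enn2real (E x) else 0)" for x
    by (auto simp: E_def)
  ultimately have "((\<lambda>x. enn2real (E x)) has_integral pi / (2 * sqrt 2)) {0..1}"
    by (subst has_integral_restrict_UNIV[symmetric]) simp
  then show ?thesis
    \<comment> \<open>At \<open>x = 1/2\<close> the modulus is 1, and the defining integral of \<open>K\<close> diverges.\<close>
  proof (rule has_integral_spike[rotated 2])
    fix x :: real
    assume x: "x \<in> {0..1} - {1/2}"
    have w: "0 \<le> x * (1 - x)" using x by auto
    have "0 < (2 * x - 1)\<^sup>2" using x by simp
    then have "4 * (x * (1 - x)) < 1" by (simp add: power2_eq_square algebra_simps)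
    then have k: "(2 * sqrt (x * (1 - x)))\<^sup>2 < 1" using w by (simp add: power_mult_distrib)
    have "E x = ennreal (elliptic_K (2 * sqrt (x * (1 - x)))) *
         ennreal (x * (1 - x) / (1 - 2 * x * (1 - x)) powr (3/2))"
      unfolding E_def nn_elliptic_K_eq[OF k] using x by simp
    then show "elliptic_K (2 * sqrt (x * (1 - x))) * (x * (1 - x)) / (1 - 2 * x * (1 - x)) powr (3/2)
         = enn2real (E x)"
      using elliptic_K_nonneg[OF k] w by (simp add: enn2real_mult)
  qed simp
qed

end
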